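(* Let $p$ be an odd prime and let $G$ be a $p$-group of order $p^m$ of rank $3$. Then (1) $\displaystyle A_G(t/|G|)=\frac{1-p^{-2}}{1-p^{-1}t} + \frac{p^{-2}}{1-t}$; (2) $\displaystyle B_G(t/|G|)=\frac{-p^{-1}}{1-p^{-2}t} + \frac{1+p^{-1}}{1-p^{-1}t}$.
   Context: For a finite group $G$ and $n\ge 0$, $\alpha_{G,n}$ denotes the number of orbits of $G$ acting on $G^n$ by simultaneous conjugation $g\cdot(x_1,\dots,x_n)=(gx_1g^{-1},\dots,gx_ng^{-1})$, and $\beta_{G,n}$ denotes the number of orbits of the same action on the set $G^{(n)}$ of $n$-tuples of pairwise commuting elements of $G$; $\alpha_{G,0}=\beta_{G,0}=1$. Set $A_G(t)=\sum_{n\ge 0}\alpha_{G,n}t^n$ and $B_G(t)=\sum_{n\ge 0}\beta_{G,n}t^n$ (formal power series, which are rational functions of $t$). $A_G(t/|G|)$, $B_G(t/|G|)$ denote the result of substituting $t/|G|$ for $t$. Finite groups $G,H$ are isoclinic if there are isomorphisms $\theta:G/Z(G)\to H/Z(H)$ and $\phi:G'\to H'$ (derived subgroups) such that $\phi([g_1,g_2])=[h_1,h_2]$ whenever $\theta(g_iZ(G))=h_iZ(H)$ for $i=1,2$. Isoclinism is an equivalence relation, whose classes are called isoclinism families. For a $p$-group $G$, the rank of (the family of) $G$ is the smallest $r$ such that the isoclinism family of $G$ contains a group of order $p^r$; equivalently $p^r=|G/Z(G)|\,|Z(G)\cap G'|$. *)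

theory Defs
  imports
    "HOL-Algebra.Group_Action"
    "HOL-Algebra.Generated_Groups"
    "HOL-Computational_Algebra.Formal_Power_Series"
begin

definition tuples :: "('a, 'b) monoid_scheme \<Rightarrow> nat \<Rightarrow> 'a list set" where
  "tuples G n = {xs. length xs = n \<and> set xs \<subseteq> carrier G}"

definition commuting_tuples :: "('a, 'b) monoid_scheme \<Rightarrow> nat \<Rightarrow> 'a list set" where
  "commuting_tuples G n =
     {xs \<in> tuples G n. \<forall>x\<in>set xs. \<forall>y\<in>set xs. x \<otimes>\<^bsub>G\<^esub> y = y \<otimes>\<^bsub>G\<^esub> x}"

text \<open>The bounded abstraction makes each map extensional on \<open>E\<close>, as the library's
  \<^locale>\<open>group_action\<close> demands.\<close>

definition conj_action ::
  "('a, 'b) monoid_scheme \<Rightarrow> 'a list set \<Rightarrow> 'a \<Rightarrow> 'a list \<Rightarrow> 'a list" where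
  "conj_action G E = (\<lambda>g. \<lambda>xs\<in>E. map (\<lambda>x. g \<otimes>\<^bsub>G\<^esub> x \<otimes>\<^bsub>G\<^esub> inv\<^bsub>G\<^esub> g) xs)"

definition conj_count :: "('a, 'b) monoid_scheme \<Rightarrow> nat \<Rightarrow> nat" where
  "conj_count G n = card (orbits G (tuples G n) (conj_action G (tuples G n)))"

definition comm_conj_count :: "('a, 'b) monoid_scheme \<Rightarrow> nat \<Rightarrow> nat" where
  "comm_conj_count G n =
     card (orbits G (commuting_tuples G n) (conj_action G (commuting_tuples G n)))"

definition conj_fps :: "('a, 'b) monoid_scheme \<Rightarrow> rat fps" where
  "conj_fps G = Abs_fps (\<lambda>n. of_nat (conj_count G n))"

definition comm_conj_fps :: "('a, 'b) monoid_scheme \<Rightarrow> rat fps" where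
  "comm_conj_fps G = Abs_fps (\<lambda>n. of_nat (comm_conj_count G n))"

definition group_center :: "('a, 'b) monoid_scheme \<Rightarrow> 'a set" where
  "group_center G = {z \<in> carrier G. \<forall>g\<in>carrier G. z \<otimes>\<^bsub>G\<^esub> g = g \<otimes>\<^bsub>G\<^esub> z}"

text \<open>Same convention as in \<^const>\<open>derived\<close>; replacing it by \<open>g\<inverse> h\<inverse> g h\<close> throughout would
  not affect isoclinism.\<close>

definition commutator :: "('a, 'b) monoid_scheme \<Rightarrow> 'a \<Rightarrow> 'a \<Rightarrow> 'a" where
  "commutator G g h = g \<otimes>\<^bsub>G\<^esub> h \<otimes>\<^bsub>G\<^esub> inv\<^bsub>G\<^esub> g \<otimes>\<^bsub>G\<^esub> inv\<^bsub>G\<^esub> h"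

definition isoclinic :: "('a, 'c) monoid_scheme \<Rightarrow> ('b, 'd) monoid_scheme \<Rightarrow> bool" where
  "isoclinic G H \<longleftrightarrow>
     (\<exists>\<theta> \<in> iso (G Mod group_center G) (H Mod group_center H).
      \<exists>\<phi> \<in> iso (G\<lparr>carrier := derived G (carrier G)\<rparr>) (H\<lparr>carrier := derived H (carrier H)\<rparr>).
        \<forall>g1\<in>carrier G. \<forall>g2\<in>carrier G. \<forall>h1\<in>carrier H. \<forall>h2\<in>carrier H.
          \<theta> (group_center G #>\<^bsub>G\<^esub> g1) = group_center H #>\<^bsub>H\<^esub> h1 \<longrightarrow>
          \<theta> (group_center G #>\<^bsub>G\<^esub> g2) = group_center H #>\<^bsub>H\<^esub> h2 \<longrightarrow>
          \<phi> (commutator G g1 g2) = commutator H h1 h2)"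

text \<open>Since every finite group has an isomorphic copy with carrier in \<^typ>\<open>nat\<close>, letting
  \<open>H\<close> range over groups on \<^typ>\<open>nat\<close> covers all members of the isoclinism family up to
  isomorphism. In particular, for \<open>G\<close> of order \<open>p ^ m\<close> the set of admissible \<open>r\<close> contains
  \<open>m\<close>, so \<open>LEAST\<close> is meaningful.\<close>

definition isoclinic_rank :: "nat \<Rightarrow> ('a, 'b) monoid_scheme \<Rightarrow> nat" where
  "isoclinic_rank p G =
     (LEAST r. \<exists>H :: nat monoid. group H \<and> order H = p ^ r \<and> isoclinic G H)"

end

theory Submission
  imports Defs "HOL-Algebra.Weak_Morphisms" "HOL-Algebra.Elementary_Groups"
begin

text \<open>
  By Burnside's lemma, \<open>\<alpha>\<^sub>n |G| = \<Sum>\<^sub>g |C(g)| ^ n\<close>, and \<open>\<beta>\<^sub>n |G|\<close> is the number of commuting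
  \<open>(n + 1)\<close>-tuples. Both are determined by \<open>|G : Z(G)| = p\<^sup>2\<close>: the centralizer of a noncentral element
  then has order \<open>p |Z(G)|\<close> and is abelian. So \<open>\<Sum>\<^sub>g |C(g)| ^ n\<close> has only two kinds of terms, and the
  elements commuting with a commuting tuple having a noncentral entry \<open>y\<close> are those of \<open>C(y)\<close>, which
  gives a linear recursion for the number of such tuples.

  The index of the center is an isoclinism invariant. Rank 3 provides an isoclinic group of order
  \<open>p\<^sup>3\<close>, whose center is nontrivial and cannot have index \<open>p\<close>; it is not abelian either, since
  abelian groups have rank 0. This leaves index \<open>p\<^sup>2\<close>.
\<close>

section \<open>Geometric series as quotients of formal power series\<close>

text \<open>Multiplying the series by the denominator telescopes to the constant \<open>a\<close>,
  and the nonzero denominator can then be cancelled.\<close>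

lemma fps_const_divide_one_minus_const_X:
  fixes a c :: "'a :: field"
  shows "fps_const a / (1 - fps_const c * fps_X) = Abs_fps (\<lambda>n. a * c ^ n)"
proof -
  let ?d = "1 - fps_const c * fps_X"
  have d: "f * ?d = f - fps_const c * (fps_X * f)" for f :: "'a fps"
    by (simp add: algebra_simps)
  have "Abs_fps (\<lambda>n. a * c ^ n) * ?d = fps_const a"
  proof (rule fps_ext)
    fix n
    show "fps_nth (Abs_fps (\<lambda>n. a * c ^ n) * ?d) n = fps_nth (fps_const a) n"
      unfolding d by (cases n) simp_all
  qed
  moreover have "?d \<noteq> 0"
  proof
    assume "?d = 0"
    then have "fps_nth ?d 0 = 0" by (simp only: fps_zero_nth)
    then show False by simp
  qed
  ultimately show ?thesis by (metis nonzero_mult_div_cancel_right)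
qed

subsection \<open>Centralizers and the center\<close>

definition elem_centralizer :: "('a, 'b) monoid_scheme \<Rightarrow> 'a \<Rightarrow> 'a set" where
  "elem_centralizer G g = {x \<in> carrier G. x \<otimes>\<^bsub>G\<^esub> g = g \<otimes>\<^bsub>G\<^esub> x}"

context group
begin

lemma elem_centralizer_subgroup:
  assumes g: "g \<in> carrier G"
  shows "subgroup (elem_centralizer G g) G"
proof (rule subgroupI)
  fix a b assume "a \<in> elem_centralizer G g" "b \<in> elem_centralizer G g"
  then show "a \<otimes> b \<in> elem_centralizer G g"
    using g unfolding elem_centralizer_def by (auto simp: m_assoc) (metis m_assoc)
next
  fix a assume a: "a \<in> elem_centralizer G g"
  then have "a \<in> carrier G" "a \<otimes> g = g \<otimes> a" by (auto simp: elem_centralizer_def)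
  then have "inv a \<otimes> g = g \<otimes> inv a"
    by (metis g inv_closed inv_solve_left inv_solve_right m_assoc m_closed)
  then show "inv a \<in> elem_centralizer G g"
    using \<open>a \<in> carrier G\<close> by (simp add: elem_centralizer_def)
qed (use g in \<open>auto simp: elem_centralizer_def\<close>)

lemma group_center_eq_INT:
  "group_center G = (\<Inter>g\<in>carrier G. elem_centralizer G g)"
  by (auto simp: group_center_def elem_centralizer_def)

lemma group_center_subset: "group_center G \<subseteq> carrier G"
  by (auto simp: group_center_def)

lemma group_center_le_centralizer:
  "g \<in> carrier G \<Longrightarrow> group_center G \<subseteq> elem_centralizer G g"
  by (auto simp: group_center_def elem_centralizer_def)

lemma group_center_subgroup: "subgroup (group_center G) G"
proof -
  have "subgroup (\<Inter> (elem_centralizer G ` carrier G)) G"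
    by (rule subgroups_Inter) (auto simp: elem_centralizer_subgroup)
  then show ?thesis by (simp add: group_center_eq_INT)
qed

lemma centralizer_proper:
  assumes "g \<in> carrier G" "g \<notin> group_center G"
  shows "elem_centralizer G g \<noteq> carrier G" "g \<in> elem_centralizer G g"
proof -
  obtain x where "x \<in> carrier G" "g \<otimes> x \<noteq> x \<otimes> g"
    using assms unfolding group_center_def by blast
  then have "x \<in> carrier G - elem_centralizer G g" by (auto simp: elem_centralizer_def)
  then show "elem_centralizer G g \<noteq> carrier G" by blast
  show "g \<in> elem_centralizer G g" using assms by (simp add: elem_centralizer_def)
qed

lemma card_subgroup_dvd:
  assumes "subgroup H G" "subgroup K G" "H \<subseteq> K"
  shows "card H dvd card K"
proof -
  interpret K: group "G\<lparr>carrier := K\<rparr>"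
    using assms(2) by (rule subgroup_imp_group)
  have "subgroup H (G\<lparr>carrier := K\<rparr>)"
    using assms by (rule subgroup_incl)
  from K.lagrange[OF this] show ?thesis
    by (simp add: order_def) (metis dvd_triv_right)
qed

lemma conj_eq_iff_commute:
  assumes "g \<in> carrier G" "x \<in> carrier G"
  shows "g \<otimes> x \<otimes> inv g = x \<longleftrightarrow> x \<otimes> g = g \<otimes> x"
  using assms by (metis inv_solve_right' m_closed)

section \<open>Centers of groups of prime power order\<close>

text \<open>Class equation: if the center were trivial, the class of the identity would be the only
  one of size 1. All other classes have size a positive power of \<open>p\<close>, so
  \<open>p\<close> would divide 1.\<close>

lemma card_group_center_primepow:
  assumes "prime p" "order G = p ^ k" "k > 0"
  shows "card (group_center G) \<noteq> 1"
proof
  assume "card (group_center G) = 1"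
  then have Z: "group_center G = {\<one>}"
    by (metis card_1_singletonE group_center_subgroup singletonD subgroup.one_closed)
  have "order G > 0" using assms prime_gt_0_nat by auto
  then have fin: "finite (carrier G)" by (simp add: order_gt_0_iff_finite)
  define c where "c = (\<lambda>g. \<lambda>h\<in>carrier G. g \<otimes> h \<otimes> inv g)"
  let ?O = "orbits G (carrier G) c"
  interpret A: group_action G "carrier G" c unfolding c_def by (rule action_by_conjugation)
  have orbit_one: "{\<one>} = orbit G c \<one>"
    by (auto simp: orbit_def c_def intro!: exI[of _ \<one>])
  then have one_in: "{\<one>} \<in> ?O" unfolding orbits_def by blast
  have finO: "finite ?O" using fin by (simp add: orbits_def setcompr_eq_image)
  have dvd: "p dvd card orb" if orb: "orb \<in> ?O - {{\<one>}}" for orb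
  proof -
    obtain x where x: "x \<in> carrier G" "orb = orbit G c x"
      using orb unfolding orbits_def by blast
    have "card orb dvd p ^ k"
      using A.orbit_stabilizer_theorem[OF x(1)] assms(2) x(2) by (metis dvd_triv_left)
    then obtain i where i: "card orb = p ^ i"
      using assms(1) by (auto simp: divides_primepow_nat)
    \<comment> \<open>A class of size 1 is \<open>{x}\<close> with \<open>x\<close> fixed by every
      conjugation. Then \<open>x\<close> is central, hence the identity, whose class has been
      removed.\<close>
    have "i \<noteq> 0"
    proof
      assume "i = 0"
      then obtain y where "orb = {y}" using i by (auto simp: card_1_singleton_iff)
      with A.orbit_refl[OF x(1)] x have orbx: "orbit G c x = {x}" by (metis singletonD)
      have "x \<otimes> g = g \<otimes> x" if "g \<in> carrier G" for g
      proof -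
        have "c g x \<in> orbit G c x" using that unfolding orbit_def by blast
        then have "g \<otimes> x \<otimes> inv g = x" using orbx x by (simp add: c_def)
        then show ?thesis using conj_eq_iff_commute that x by blast
      qed
      then have "x \<in> group_center G" using x by (simp add: group_center_def)
      then show False using Z orb orbx x by auto
    qed
    then show ?thesis using i by simp
  qed
  \<comment> \<open>The classes partition the carrier, so the constant 1 is summed class by
    class.\<close>
  have "order G = (\<Sum>orb\<in>?O. card orb)"
    using A.disjoint_sum[OF fin, of "\<lambda>_. 1 :: nat"] by (simp add: order_def)
  also have "\<dots> = 1 + (\<Sum>orb\<in>?O - {{\<one>}}. card orb)"
    using finO one_in by (subst sum.remove[of _ "{\<one>}"]) auto
  finally have "p ^ k = 1 + (\<Sum>orb\<in>?O - {{\<one>}}. card orb)" using assms(2) by simp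
  moreover have "p dvd p ^ k" using assms(3) by simp
  moreover have "p dvd (\<Sum>orb\<in>?O - {{\<one>}}. card orb)" using dvd by (rule dvd_sum)
  ultimately have "p dvd 1" by (metis dvd_add_left_iff)
  then show False using assms(1) by (metis not_prime_unit)
qed

text \<open>A center of order 1 is excluded by the class equation. If its order were
  \<open>p ^ 2\<close>, the centralizer of a noncentral element would lie strictly between the
  center and the group, and no power of \<open>p\<close> lies strictly between \<open>p ^ 2\<close>
  and \<open>p ^ 3\<close>.\<close>

lemma center_index_order_prime_cubed:
  assumes p: "prime p" and ord: "order G = p ^ 3"
  shows "card (rcosets (group_center G)) = 1 \<or> card (rcosets (group_center G)) = p ^ 2"
proof -
  have p1: "p > 1" using p by (rule prime_gt_1_nat)
  then have fin: "finite (carrier G)" using ord by (metis order_gt_0_iff_finite zero_less_power less_trans zero_less_one)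
  have L: "card (rcosets (group_center G)) * card (group_center G) = p ^ 3"
    using lagrange[OF group_center_subgroup] ord by simp
  then have "card (group_center G) dvd p ^ 3" by (metis dvd_triv_right)
  then obtain i where i: "i \<le> 3" "card (group_center G) = p ^ i"
    using p by (auto simp: divides_primepow_nat)
  have "i \<noteq> 0" using i card_group_center_primepow[OF p ord] by auto
  moreover have "i \<noteq> 2"
  proof
    assume "i = 2"
    then have "card (group_center G) \<noteq> card (carrier G)" using i ord p1 by (simp add: order_def)
    then obtain g where g: "g \<in> carrier G" "g \<notin> group_center G"
      using group_center_subset by (metis subset_antisym subsetI)
    let ?C = "elem_centralizer G g"
    note C = elem_centralizer_subgroup[OF g(1)]
    have "card ?C dvd p ^ 3"
      using lagrange[OF C] ord by (metis dvd_triv_right)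
    then obtain j where j: "card ?C = p ^ j" using p by (auto simp: divides_primepow_nat)
    have "?C \<subset> carrier G" using centralizer_proper[OF g] subgroup.subset[OF C] by blast
    then have "card ?C < p ^ 3" using fin ord psubset_card_mono unfolding order_def by metis
    moreover have "group_center G \<subset> ?C"
      using centralizer_proper[OF g] group_center_le_centralizer g by blast
    then have "p ^ 2 < card ?C"
      using i \<open>i = 2\<close> fin subgroup.subset[OF C] by (metis psubset_card_mono finite_subset)
    ultimately show False using j p1 by simp
  qed
  ultimately consider "i = 1" | "i = 3" using i by linarith
  then show ?thesis
    by cases (use L i p1 in \<open>auto simp: power2_eq_square power3_eq_cube\<close>)
qed

end

subsection \<open>Counting orbits by Burnside's lemma\<close>

text \<open>The two properties that make \<open>conj_action G E\<close> a group action; tuples and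
  commuting tuples are thereby treated at once.\<close>

definition conj_invariant :: "('a, 'b) monoid_scheme \<Rightarrow> 'a list set \<Rightarrow> bool" where
  "conj_invariant G E \<longleftrightarrow> E \<subseteq> lists (carrier G) \<and>
     (\<forall>g\<in>carrier G. \<forall>xs\<in>E. map (\<lambda>x. g \<otimes>\<^bsub>G\<^esub> x \<otimes>\<^bsub>G\<^esub> inv\<^bsub>G\<^esub> g) xs \<in> E)"

context group
begin

lemma conj_conj:
  assumes "g \<in> carrier G" "h \<in> carrier G" "x \<in> carrier G"
  shows "g \<otimes> (h \<otimes> x \<otimes> inv h) \<otimes> inv g = (g \<otimes> h) \<otimes> x \<otimes> inv (g \<otimes> h)"
  using assms by (simp add: inv_mult_group m_assoc)

lemma conj_action_group_action:
  assumes E: "conj_invariant G E"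
  shows "group_action G E (conj_action G E)"
proof -
  let ?a = "conj_action G E"
  let ?m = "\<lambda>g. map (\<lambda>x. g \<otimes> x \<otimes> inv g)"
  have in_carrier: "x \<in> carrier G" if "xs \<in> E" "x \<in> set xs" for xs x
    using E that unfolding conj_invariant_def by auto
  have closed: "?m g xs \<in> E" if "g \<in> carrier G" "xs \<in> E" for g xs
    using E that unfolding conj_invariant_def by blast
  have comp: "?m g (?m h xs) = ?m (g \<otimes> h) xs"
    if "g \<in> carrier G" "h \<in> carrier G" "xs \<in> E" for g h xs
    using that in_carrier by (simp add: conj_conj)
  have one: "?m \<one> xs = xs" if "xs \<in> E" for xs
    using in_carrier[OF that] by (simp add: map_idI)
  have inv: "?m (inv g) (?m g xs) = xs" "?m g (?m (inv g) xs) = xs"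
    if "g \<in> carrier G" "xs \<in> E" for g xs
    using that comp[of "inv g" g xs] comp[of g "inv g" xs] one[OF that(2)]
    by (simp_all only: l_inv r_inv inv_closed)
  have bij: "?a g \<in> Bij E" if g: "g \<in> carrier G" for g
  proof -
    have "bij_betw (?m g) E E"
    proof (rule bij_betw_byWitness[where f' = "?m (inv g)"])
      show "\<forall>xs\<in>E. ?m (inv g) (?m g xs) = xs" "\<forall>xs\<in>E. ?m g (?m (inv g) xs) = xs"
        using inv[OF g] by blast+
      show "?m g ` E \<subseteq> E" "?m (inv g) ` E \<subseteq> E"
        using closed[OF g] closed[OF inv_closed[OF g]] by blast+
    qed
    \<comment> \<open>The restricted map agrees with \<open>?m g\<close> on \<open>E\<close>, so it
      is bijective there; being extensional as well, it belongs to \<open>Bij E\<close>.\<close>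
    then have "bij_betw (?a g) E E"
      by (subst bij_betw_cong[of E _ "?m g"]) (auto simp: conj_action_def)
    then show ?thesis by (simp add: Bij_def conj_action_def)
  qed
  have "?a (g \<otimes> h) = ?a g \<otimes>\<^bsub>BijGroup E\<^esub> ?a h"
    if "g \<in> carrier G" "h \<in> carrier G" for g h
  proof -
    have "?a g \<otimes>\<^bsub>BijGroup E\<^esub> ?a h = compose E (?a g) (?a h)"
      using bij that by (simp add: BijGroup_def)
    also have "\<dots> = ?a (g \<otimes> h)"
      unfolding conj_action_def compose_def
      by (rule restrict_ext) (use that closed comp in \<open>simp del: map_map\<close>)
    finally show ?thesis by simp
  qed
  then have "?a \<in> hom G (BijGroup E)"
    using bij by (auto simp: hom_def BijGroup_def)
  then show ?thesis
    by (simp add: group_action_def group_hom_def group_hom_axioms_def group_BijGroup)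
qed

text \<open>Burnside's lemma: conjugation by \<open>g\<close> fixes a list exactly when it fixes
  each entry, that is, when each entry commutes with \<open>g\<close>.\<close>

lemma card_conj_orbits:
  assumes "finite (carrier G)" "finite E" and E: "conj_invariant G E"
  shows "card (orbits G E (conj_action G E)) * order G =
    (\<Sum>g\<in>carrier G. card {xs \<in> E. set xs \<subseteq> elem_centralizer G g})"
proof -
  interpret group_action G E "conj_action G E"
    using E by (rule conj_action_group_action)
  have "invariants E (conj_action G E) g = {xs \<in> E. set xs \<subseteq> elem_centralizer G g}"
    if g: "g \<in> carrier G" for g
  proof -
    have "map (\<lambda>x. g \<otimes> x \<otimes> inv g) xs = xs \<longleftrightarrow> set xs \<subseteq> elem_centralizer G g"
      if "set xs \<subseteq> carrier G" for xs
      using that g by (induction xs) (auto simp: elem_centralizer_def conj_eq_iff_commute)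
    then show ?thesis
      using E by (auto simp: invariants_def conj_action_def conj_invariant_def in_lists_conv_set subset_iff)
  qed
  then show ?thesis using burnside[OF assms(1,2)] by simp
qed

lemma finite_tuples: "finite (carrier G) \<Longrightarrow> finite (tuples G n)"
  using finite_lists_length_eq[of "carrier G" n] by (simp add: tuples_def conj_ac)

lemma finite_commuting_tuples: "finite (carrier G) \<Longrightarrow> finite (commuting_tuples G n)"
  by (simp add: commuting_tuples_def finite_tuples)

lemma conj_invariant_tuples: "conj_invariant G (tuples G n)"
  by (auto simp: conj_invariant_def tuples_def)

lemma conj_mult:
  assumes "g \<in> carrier G" "x \<in> carrier G" "y \<in> carrier G"
  shows "(g \<otimes> x \<otimes> inv g) \<otimes> (g \<otimes> y \<otimes> inv g) = g \<otimes> (x \<otimes> y) \<otimes> inv g"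
  using assms by (simp add: m_assoc) (simp flip: m_assoc)

lemma conj_invariant_commuting_tuples: "conj_invariant G (commuting_tuples G n)"
  unfolding conj_invariant_def
proof (intro conjI ballI)
  show "commuting_tuples G n \<subseteq> lists (carrier G)"
    by (auto simp: commuting_tuples_def tuples_def)
  fix g xs assume g: "g \<in> carrier G" and xs: "xs \<in> commuting_tuples G n"
  then show "map (\<lambda>x. g \<otimes> x \<otimes> inv g) xs \<in> commuting_tuples G n"
    by (auto simp: commuting_tuples_def tuples_def conj_mult subset_iff)
qed

lemma conj_count_times_order:
  assumes "finite (carrier G)"
  shows "conj_count G n * order G = (\<Sum>g\<in>carrier G. card (elem_centralizer G g) ^ n)"
proof -
  have "card {xs \<in> tuples G n. set xs \<subseteq> elem_centralizer G g} = card (elem_centralizer G g) ^ n"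
    for g
  proof -
    have sub: "elem_centralizer G g \<subseteq> carrier G" by (auto simp: elem_centralizer_def)
    then have "{xs \<in> tuples G n. set xs \<subseteq> elem_centralizer G g} =
        {xs. set xs \<subseteq> elem_centralizer G g \<and> length xs = n}"
      by (auto simp: tuples_def)
    then show ?thesis
      using card_lists_length_eq[OF finite_subset[OF sub assms]] by simp
  qed
  then show ?thesis
    using card_conj_orbits[OF assms finite_tuples[OF assms] conj_invariant_tuples]
    by (simp add: conj_count_def)
qed

lemma commuting_tuples_Cons:
  "x # xs \<in> commuting_tuples G (Suc n) \<longleftrightarrow>
    x \<in> carrier G \<and> xs \<in> commuting_tuples G n \<and> set xs \<subseteq> elem_centralizer G x"
  by (auto simp: commuting_tuples_def tuples_def elem_centralizer_def)

text \<open>A commuting tuple \<open>xs\<close> is fixed by \<open>g\<close> exactly when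
  \<open>g # xs\<close> commutes. The sum in Burnside's lemma therefore counts commuting tuples with
  one more entry, sorted by their head.\<close>

lemma comm_conj_count_times_order:
  assumes "finite (carrier G)"
  shows "comm_conj_count G n * order G = card (commuting_tuples G (Suc n))"
proof -
  let ?F = "\<lambda>g. {xs \<in> commuting_tuples G n. set xs \<subseteq> elem_centralizer G g}"
  have "commuting_tuples G (Suc n) = (\<lambda>(g, xs). g # xs) ` (SIGMA g:carrier G. ?F g)"
  proof (intro Set.set_eqI iffI)
    fix ys assume ys: "ys \<in> commuting_tuples G (Suc n)"
    then obtain g xs where "ys = g # xs"
      by (auto simp: commuting_tuples_def tuples_def length_Suc_conv)
    with ys show "ys \<in> (\<lambda>(g, xs). g # xs) ` (SIGMA g:carrier G. ?F g)"
      by (auto simp: commuting_tuples_Cons)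
  qed (auto simp: commuting_tuples_Cons)
  then have "card (commuting_tuples G (Suc n)) = card (SIGMA g:carrier G. ?F g)"
    by (simp add: card_image inj_on_def)
  also have "\<dots> = (\<Sum>g\<in>carrier G. card (?F g))"
    using assms finite_commuting_tuples[OF assms] by (intro card_SigmaI) auto
  finally show ?thesis
    using card_conj_orbits[OF assms finite_commuting_tuples[OF assms] conj_invariant_commuting_tuples]
    by (simp add: comm_conj_count_def)
qed

end

subsection \<open>Groups whose center has index \<open>p\<^sup>2\<close>\<close>

text \<open>The index is expressed as a product of orders, so that the counting below can do without
  cosets.\<close>

locale center_index_prime_square = group G for G :: "('a, 'b) monoid_scheme" (structure) +
  fixes p :: nat
  assumes finite_carrier: "finite (carrier G)"
    and prime_p: "prime p"
    and order_eq: "order G = p\<^sup>2 * card (group_center G)"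
begin

abbreviation (input) z :: nat where "z \<equiv> card (group_center G)"

lemma card_center_pos: "z > 0"
  using order_eq finite_carrier order_gt_0_iff_finite by (metis mult_0_right neq0_conv)

text \<open>Ensures that the natural number difference \<open>p\<^sup>2 * z - z\<close> is not
  truncated, so that it can be moved to the integers and rationals.\<close>

lemma center_le: "z \<le> p\<^sup>2 * z"
  using prime_gt_0_nat[OF prime_p] by simp

text \<open>By Lagrange, \<open>card A\<close> is \<open>z\<close> times a divisor of
  \<open>p ^ 2\<close>. Strictness at both ends rules out the divisors 1 and
  \<open>p ^ 2\<close>.\<close>

lemma card_intermediate_subgroup:
  assumes A: "subgroup A G" "group_center G \<subset> A" "A \<noteq> carrier G"
  shows "card A = p * z"
proof -
  have sub: "A \<subseteq> carrier G" using A(1) by (rule subgroup.subset)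
  have finA: "finite A" using sub finite_carrier finite_subset by blast
  obtain k where k: "card A = z * k"
    using card_subgroup_dvd[OF group_center_subgroup A(1)] A(2) by (auto elim: dvdE)
  have "z < card A" using finA A(2) by (rule psubset_card_mono)
  then have "k \<noteq> 1" using k by auto
  have "card A dvd order G" using lagrange[OF A(1)] by (metis dvd_triv_right)
  then have "k dvd p ^ 2" using k order_eq card_center_pos by (simp add: mult.commute)
  then obtain i where i: "i \<le> 2" "k = p ^ i" using prime_p by (auto simp: divides_primepow_nat)
  have "card A < order G"
    unfolding order_def using A sub finite_carrier by (intro psubset_card_mono) auto
  then have "i \<noteq> 2" using k i order_eq by auto
  moreover have "i \<noteq> 0" using \<open>k \<noteq> 1\<close> i by auto
  ultimately have "i = 1" using i by linarith
  then show ?thesis using k i by simp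
qed

lemma center_psubset_centralizer:
  assumes "g \<in> carrier G - group_center G"
  shows "group_center G \<subset> elem_centralizer G g"
  using assms centralizer_proper(2) group_center_le_centralizer by blast

lemma card_centralizer:
  assumes g: "g \<in> carrier G - group_center G"
  shows "card (elem_centralizer G g) = p * z"
  using g centralizer_proper(1) center_psubset_centralizer elem_centralizer_subgroup
  by (intro card_intermediate_subgroup) auto

text \<open>For noncentral \<open>x\<close>, the intersection of the centralizers of
  \<open>x\<close> and \<open>g\<close> contains the noncentral \<open>g\<close>, so it is an
  intermediate subgroup and has the same order as the centralizer of \<open>g\<close>. The two
  coincide, and everything commuting with \<open>g\<close> commutes with \<open>x\<close>.\<close>

lemma centralizer_commute:
  assumes g: "g \<in> carrier G - group_center G"
    and x: "x \<in> elem_centralizer G g" and y: "y \<in> elem_centralizer G g"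
  shows "x \<otimes> y = y \<otimes> x"
proof (cases "x \<in> group_center G")
  case True
  then show ?thesis using y by (auto simp: group_center_def elem_centralizer_def)
next
  case False
  let ?A = "elem_centralizer G x \<inter> elem_centralizer G g"
  have xG: "x \<in> carrier G" using x by (simp add: elem_centralizer_def)
  have "g \<in> ?A" using x g by (auto simp: elem_centralizer_def)
  then have "group_center G \<subset> ?A"
    using g xG group_center_le_centralizer by blast
  moreover have "subgroup ?A G"
    using g xG by (intro subgroups_Inter_pair elem_centralizer_subgroup) auto
  moreover have "?A \<noteq> carrier G"
    using g centralizer_proper(1)[of g] elem_centralizer_subgroup subgroup.subset by blast
  ultimately have "card ?A = card (elem_centralizer G g)"
    using card_intermediate_subgroup card_centralizer[OF g] by simp
  moreover have "finite (elem_centralizer G g)"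
    using finite_carrier by (simp add: elem_centralizer_def)
  ultimately have "?A = elem_centralizer G g"
    by (intro card_subset_eq) auto
  then have "y \<in> ?A" using y by simp
  then show ?thesis by (simp add: elem_centralizer_def)
qed

lemma centralizer_of_central:
  "g \<in> group_center G \<Longrightarrow> elem_centralizer G g = carrier G"
  by (auto simp: group_center_def elem_centralizer_def)

lemma card_noncentral: "card (carrier G - group_center G) = p\<^sup>2 * z - z"
  using card_Diff_subset[of "group_center G" "carrier G"] finite_carrier group_center_subset order_eq
  by (metis finite_subset order_def)

lemma conj_count_eq:
  "conj_count G n * order G = z * (order G) ^ n + (p\<^sup>2 * z - z) * (p * z) ^ n"
proof -
  let ?f = "\<lambda>g. card (elem_centralizer G g) ^ n"
  have "(\<Sum>g\<in>carrier G. ?f g) = (\<Sum>g\<in>carrier G - group_center G. ?f g) + (\<Sum>g\<in>group_center G. ?f g)"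
    using finite_carrier group_center_subset by (rule sum.subset_diff[rotated])
  also have "(\<Sum>g\<in>group_center G. ?f g) = z * (order G) ^ n"
    by (simp add: centralizer_of_central order_def)
  also have "(\<Sum>g\<in>carrier G - group_center G. ?f g) = (p\<^sup>2 * z - z) * (p * z) ^ n"
    by (simp add: card_centralizer card_noncentral)
  finally show ?thesis by (simp add: conj_count_times_order[OF finite_carrier])
qed

section \<open>A recursion for the number of commuting tuples\<close>

definition noncentral_tuples :: "nat \<Rightarrow> 'a list set" where
  "noncentral_tuples n = {xs \<in> commuting_tuples G n. \<not> set xs \<subseteq> group_center G}"

text \<open>Central entries commute automatically, so these are all lists of length \<open>n\<close>
  over the center and their number is a plain power.\<close>

definition central_tuples :: "nat \<Rightarrow> 'a list set" where
  "central_tuples n = {xs. set xs \<subseteq> group_center G \<and> length xs = n}"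

lemma finite_center: "finite (group_center G)"
  using finite_carrier group_center_subset finite_subset by blast

lemma card_central_tuples: "card (central_tuples n) = z ^ n"
  unfolding central_tuples_def by (rule card_lists_length_eq[OF finite_center])

lemma finite_central_tuples: "finite (central_tuples n)"
  unfolding central_tuples_def using finite_center by (rule finite_lists_length_eq)

lemma finite_noncentral_tuples: "finite (noncentral_tuples n)"
  by (simp add: noncentral_tuples_def finite_commuting_tuples finite_carrier)

lemma commuting_tuples_split:
  "commuting_tuples G n = central_tuples n \<union> noncentral_tuples n"
  "central_tuples n \<inter> noncentral_tuples n = {}"
  using group_center_subset
  by (auto simp: noncentral_tuples_def central_tuples_def commuting_tuples_def tuples_def group_center_def)

text \<open>Fix a noncentral entry \<open>y\<close>. All entries lie in its centralizer, which is
  abelian; hence commuting with \<open>y\<close> alone already forces commuting with the whole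
  tuple.\<close>

lemma card_extensions:
  assumes xs: "xs \<in> noncentral_tuples n"
  shows "card {x \<in> carrier G. set xs \<subseteq> elem_centralizer G x} = p * z"
proof -
  have comm: "u \<in> carrier G" "u \<otimes> v = v \<otimes> u" if "u \<in> set xs" "v \<in> set xs" for u v
    using xs that by (auto simp: noncentral_tuples_def commuting_tuples_def tuples_def)
  obtain y where y: "y \<in> set xs" "y \<notin> group_center G"
    using xs by (auto simp: noncentral_tuples_def)
  then have yG: "y \<in> carrier G - group_center G" using comm by auto
  have "{x \<in> carrier G. set xs \<subseteq> elem_centralizer G x} = elem_centralizer G y"
  proof (intro Set.set_eqI iffI)
    fix x assume x: "x \<in> elem_centralizer G y"
    have "v \<otimes> x = x \<otimes> v" if "v \<in> set xs" for v
      using centralizer_commute[OF yG _ x] comm[OF that y(1)] by (simp add: elem_centralizer_def)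
    then show "x \<in> {x \<in> carrier G. set xs \<subseteq> elem_centralizer G x}"
      using x comm(1) by (auto simp: elem_centralizer_def)
  qed (use y in \<open>auto simp: elem_centralizer_def\<close>)
  then show ?thesis using card_centralizer[OF yG] by simp
qed

text \<open>Split by the tail. A central tail requires a noncentral head, which may be arbitrary; a
  tail with a noncentral entry admits exactly \<open>p * z\<close> heads.\<close>

lemma card_noncentral_tuples_Suc:
  "card (noncentral_tuples (Suc n)) = (p\<^sup>2 * z - z) * z ^ n + p * z * card (noncentral_tuples n)"
proof -
  let ?N = "carrier G - group_center G"
  \<comment> \<open>In \<open>?d\<close> the tail comes first, since \<open>?S\<close> is fibred
    over the tails: its fibres are the sets of admissible heads and have constant size.\<close>
  let ?c = "\<lambda>(x, xs). x # xs" and ?d = "\<lambda>(xs, x). x # xs"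
  let ?S = "SIGMA xs:noncentral_tuples n. {x \<in> carrier G. set xs \<subseteq> elem_centralizer G x}"
  have "noncentral_tuples (Suc n) = ?c ` (?N \<times> central_tuples n) \<union> ?d ` ?S"
  proof (intro Set.set_eqI iffI)
    fix ys assume ys: "ys \<in> noncentral_tuples (Suc n)"
    then obtain x xs where "ys = x # xs"
      by (auto simp: noncentral_tuples_def commuting_tuples_def tuples_def length_Suc_conv)
    with ys show "ys \<in> ?c ` (?N \<times> central_tuples n) \<union> ?d ` ?S"
      unfolding noncentral_tuples_def central_tuples_def
      by (cases "set xs \<subseteq> group_center G")
        (auto simp: commuting_tuples_Cons, auto simp: commuting_tuples_def tuples_def)
  next
    fix ys assume "ys \<in> ?c ` (?N \<times> central_tuples n) \<union> ?d ` ?S"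
    then show "ys \<in> noncentral_tuples (Suc n)"
    proof
      assume "ys \<in> ?c ` (?N \<times> central_tuples n)"
      then obtain x xs where *: "ys = x # xs" "x \<in> ?N" "xs \<in> central_tuples n" by auto
      moreover have "xs \<in> commuting_tuples G n"
        using * commuting_tuples_split(1) by auto
      moreover have "set xs \<subseteq> elem_centralizer G x"
        using * group_center_le_centralizer by (auto simp: central_tuples_def)
      ultimately show ?thesis by (auto simp: noncentral_tuples_def commuting_tuples_Cons)
    qed (auto simp: noncentral_tuples_def commuting_tuples_Cons)
  qed
  moreover have "?c ` (?N \<times> central_tuples n) \<inter> ?d ` ?S = {}"
    using commuting_tuples_split(2)[of n] by auto
  moreover have "finite ?S"
    using finite_noncentral_tuples finite_carrier by (intro finite_SigmaI) auto
  ultimately have "card (noncentral_tuples (Suc n)) = card (?c ` (?N \<times> central_tuples n)) + card (?d ` ?S)"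
    using finite_carrier finite_central_tuples by (simp add: card_Un_disjoint)
  moreover have "card (?c ` (?N \<times> central_tuples n)) = (p\<^sup>2 * z - z) * z ^ n"
    by (subst card_image)
      (auto simp: inj_on_def card_cartesian_product card_noncentral card_central_tuples)
  moreover have "card (?d ` ?S) = card ?S"
    by (rule card_image) (auto simp: inj_on_def)
  moreover have "card ?S = p * z * card (noncentral_tuples n)"
    using finite_noncentral_tuples finite_carrier by (subst card_SigmaI) (auto simp: card_extensions)
  ultimately show ?thesis by simp
qed

text \<open>The closed form can be read off from the structure: the centralizers of noncentral
  elements are \<open>p + 1\<close> subgroups of order \<open>p * z\<close>, any two meeting in the
  center, and each tuple lies in exactly one of them. The proof solves the recursion
  instead.\<close>

lemma card_noncentral_tuples:
  "int (card (noncentral_tuples n)) = (int p + 1) * ((int p * int z) ^ n - int z ^ n)"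
proof (induction n)
  case 0
  have "noncentral_tuples 0 = {}"
    by (auto simp: noncentral_tuples_def commuting_tuples_def tuples_def)
  then show ?case by simp
next
  case (Suc n)
  have "int (card (noncentral_tuples (Suc n))) =
      (int p ^ 2 * int z - int z) * int z ^ n + int p * int z * int (card (noncentral_tuples n))"
    by (simp add: card_noncentral_tuples_Suc of_nat_diff[OF center_le])
  then show ?case unfolding Suc.IH by (simp add: algebra_simps power2_eq_square)
qed

lemma card_commuting_tuples:
  "int (card (commuting_tuples G n)) = (int p + 1) * (int p * int z) ^ n - int p * int z ^ n"
proof -
  have "card (commuting_tuples G n) = z ^ n + card (noncentral_tuples n)"
    unfolding commuting_tuples_split(1)
    by (subst card_Un_disjoint)
      (simp_all add: finite_central_tuples finite_noncentral_tuples commuting_tuples_split card_central_tuples)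
  then show ?thesis by (simp add: card_noncentral_tuples algebra_simps)
qed

section \<open>From counts to generating functions\<close>

text \<open>Division of \<open>conj_count_eq\<close> by the power \<open>n + 1\<close> of the order
  cancels \<open>z\<close>: the ratios to the order are \<open>1 / p ^ 2\<close> for
  \<open>z\<close> and \<open>1 / p\<close> for \<open>p * z\<close>.\<close>

lemma conj_count_div_order:
  "of_nat (conj_count G n) / of_nat (order G) ^ n =
    (1 - 1 / of_nat p ^ 2) * (1 / of_nat p) ^ n + (1 / of_nat p ^ 2 :: rat)"
proof -
  define P Z where "P = (of_nat p :: rat)" and "Z = (of_nat z :: rat)"
  have nz: "P \<noteq> 0" "Z \<noteq> 0" using prime_p card_center_pos by (auto simp: P_def Z_def)
  have ord: "(of_nat (order G) :: rat) = P ^ 2 * Z" by (simp add: order_eq P_def Z_def)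
  have "of_nat (conj_count G n * order G) =
      Z * (P ^ 2 * Z) ^ n + (P ^ 2 * Z - Z) * (P * Z) ^ n"
    unfolding conj_count_eq by (simp add: order_eq P_def Z_def of_nat_diff[OF center_le])
  then have "of_nat (conj_count G n) * (P ^ 2 * Z) =
      Z * (P ^ 2 * Z) ^ n + (P ^ 2 * Z - Z) * (P * Z) ^ n"
    by (simp add: order_eq P_def Z_def)
  then have "of_nat (conj_count G n) =
      (Z * (P ^ 2 * Z) ^ n + (P ^ 2 * Z - Z) * (P * Z) ^ n) / (P ^ 2 * Z)"
    using nz by (simp add: eq_divide_eq)
  moreover have "(Z * (P ^ 2 * Z) ^ n + (P ^ 2 * Z - Z) * (P * Z) ^ n) / (P ^ 2 * Z) / (P ^ 2 * Z) ^ n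
      = (1 - 1 / P ^ 2) * (1 / P) ^ n + 1 / P ^ 2"
    using nz by (simp add: field_simps power_mult_distrib power2_eq_square)
  ultimately show ?thesis unfolding P_def[symmetric] ord by (simp only:)
qed

text \<open>The tuples counted have length \<open>n + 1\<close>. The extra factors
  \<open>1 / p\<close> and \<open>1 / p ^ 2\<close> turn the coefficients \<open>p + 1\<close> and
  \<open>- p\<close> into \<open>1 + 1 / p\<close> and \<open>- (1 / p)\<close>.\<close>

lemma comm_conj_count_div_order:
  "of_nat (comm_conj_count G n) / of_nat (order G) ^ n =
    - (1 / of_nat p) * (1 / of_nat p ^ 2) ^ n + (1 + 1 / of_nat p) * (1 / of_nat p :: rat) ^ n"
proof -
  define P Z where "P = (of_nat p :: rat)" and "Z = (of_nat z :: rat)"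
  have nz: "P \<noteq> 0" "Z \<noteq> 0" using prime_p card_center_pos by (auto simp: P_def Z_def)
  have ord: "(of_nat (order G) :: rat) = P ^ 2 * Z" by (simp add: order_eq P_def Z_def)
  have "(of_nat (comm_conj_count G n) :: rat) * of_nat (order G) =
      of_int (int (card (commuting_tuples G (Suc n))))"
    using comm_conj_count_times_order[OF finite_carrier, of n] by (metis of_int_of_nat_eq of_nat_mult)
  also have "\<dots> = (P + 1) * (P * Z) ^ Suc n - P * Z ^ Suc n"
    unfolding card_commuting_tuples by (simp add: P_def Z_def)
  finally have "of_nat (comm_conj_count G n) = ((P + 1) * (P * Z) ^ Suc n - P * Z ^ Suc n) / (P ^ 2 * Z)"
    using nz by (simp add: eq_divide_eq ord)
  moreover have "((P + 1) * (P * Z) ^ Suc n - P * Z ^ Suc n) / (P ^ 2 * Z) / (P ^ 2 * Z) ^ n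
      = - (1 / P) * (1 / P ^ 2) ^ n + (1 + 1 / P) * (1 / P) ^ n"
    using nz by (simp add: field_simps power_mult_distrib power2_eq_square)
  ultimately show ?thesis unfolding P_def[symmetric] ord by (simp only:)
qed

lemma conj_fps_eq:
  "conj_fps G oo (fps_const (1 / of_nat (order G)) * fps_X) =
    fps_const (1 - 1 / of_nat p ^ 2) / (1 - fps_const (1 / of_nat p) * fps_X)
    + fps_const (1 / of_nat p ^ 2) / (1 - fps_X)"
proof -
  \<comment> \<open>The geometric series of ratio 1, whose denominator does not literally show the
    constant factor.\<close>
  have "fps_const (1 / of_nat p ^ 2 :: rat) / (1 - fps_X) = Abs_fps (\<lambda>n. 1 / of_nat p ^ 2)"
    using fps_const_divide_one_minus_const_X[of "1 / of_nat p ^ 2 :: rat" 1] by simp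
  then show ?thesis
    using conj_count_div_order
    by (simp add: fps_const_divide_one_minus_const_X fps_eq_iff conj_fps_def power_one_over)
qed

lemma comm_conj_fps_eq:
  "comm_conj_fps G oo (fps_const (1 / of_nat (order G)) * fps_X) =
    fps_const (- (1 / of_nat p)) / (1 - fps_const (1 / of_nat p ^ 2) * fps_X)
    + fps_const (1 + 1 / of_nat p) / (1 - fps_const (1 / of_nat p) * fps_X)"
  unfolding fps_const_divide_one_minus_const_X
  using comm_conj_count_div_order
  by (simp add: fps_eq_iff comm_conj_fps_def power_one_over)

end

subsection \<open>Isoclinism\<close>

lemma isoclinic_card_center_cosets:
  assumes "isoclinic G H"
  shows "card (rcosets\<^bsub>G\<^esub> group_center G) = card (rcosets\<^bsub>H\<^esub> group_center H)"
proof -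
  have "G Mod group_center G \<cong> H Mod group_center H"
    using assms by (auto simp: isoclinic_def intro: is_isoI)
  then show ?thesis by (auto dest: iso_same_card simp: FactGroup_def)
qed

section \<open>Commutators modulo the center\<close>

context group
begin

text \<open>Each central factor can be moved next to its inverse. Commutators thus depend only on
  cosets of the center, which makes the compatibility condition of isoclinism independent of
  representatives.\<close>

lemma commutator_mult_center:
  assumes "a \<in> carrier G" "b \<in> carrier G" "u \<in> group_center G" "v \<in> group_center G"
  shows "commutator G (u \<otimes> a) (v \<otimes> b) = commutator G a b"
proof -
  have u: "u \<in> carrier G" "\<And>g. g \<in> carrier G \<Longrightarrow> u \<otimes> g = g \<otimes> u"
    and v: "v \<in> carrier G" "\<And>g. g \<in> carrier G \<Longrightarrow> v \<otimes> g = g \<otimes> v"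
    using assms by (auto simp: group_center_def)
  have "commutator G (u \<otimes> a) (v \<otimes> b) = u \<otimes> (a \<otimes> (v \<otimes> b) \<otimes> inv a) \<otimes> inv u \<otimes> inv (v \<otimes> b)"
    using assms u(1) v(1) by (simp add: commutator_def inv_mult_group m_assoc)
  also have "u \<otimes> (a \<otimes> (v \<otimes> b) \<otimes> inv a) \<otimes> inv u = a \<otimes> (v \<otimes> b) \<otimes> inv a"
    using assms u v(1) by (simp add: inv_solve_right')
  also have "\<dots> \<otimes> inv (v \<otimes> b) = v \<otimes> (a \<otimes> b \<otimes> inv a \<otimes> inv b) \<otimes> inv v"
  proof -
    have "a \<otimes> (v \<otimes> b) = v \<otimes> (a \<otimes> b)"
      using assms v(1) v(2)[of a] by (simp flip: m_assoc)
    then show ?thesis using assms v(1) by (simp add: inv_mult_group m_assoc)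
  qed
  also have "\<dots> = commutator G a b"
    using assms v by (simp add: commutator_def inv_solve_right')
  finally show ?thesis .
qed

lemma commutator_center_cosets:
  assumes "a \<in> carrier G" "b \<in> carrier G" "c \<in> carrier G" "d \<in> carrier G"
    and "group_center G #> a = group_center G #> c" "group_center G #> b = group_center G #> d"
  shows "commutator G a b = commutator G c d"
proof -
  have "a \<in> group_center G #> c" "b \<in> group_center G #> d"
    using rcos_self[OF assms(1) group_center_subgroup] rcos_self[OF assms(2) group_center_subgroup]
      assms(5,6) by simp_all
  then obtain u v where "u \<in> group_center G" "a = u \<otimes> c" "v \<in> group_center G" "b = v \<otimes> d"
    by (auto simp: r_coset_def)
  then show ?thesis using assms commutator_mult_center by simp
qed

end

text \<open>The isomorphism \<open>h\<close> induces both maps: taking images of cosets gives the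
  one between the central quotients, and \<open>h\<close> itself restricts to the derived subgroups.
  Compatibility follows because commutators depend only on cosets of the center.\<close>

lemma isoclinic_iso:
  assumes G: "group G" and H: "group H" and h: "h \<in> iso G H"
  shows "isoclinic G H"
proof -
  interpret group_hom G H h
    using assms by (simp add: group_hom_def group_hom_axioms_def iso_imp_homomorphism)
  let ?Z = "group_center G" and ?W = "group_center H"
  have inj: "inj_on h (carrier G)" and surj: "h ` carrier G = carrier H"
    using h by (auto simp: iso_def bij_betw_def)
  have comm: "h x \<otimes>\<^bsub>H\<^esub> h y = h y \<otimes>\<^bsub>H\<^esub> h x \<longleftrightarrow> x \<otimes>\<^bsub>G\<^esub> y = y \<otimes>\<^bsub>G\<^esub> x"
    if "x \<in> carrier G" "y \<in> carrier G" for x y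
    using inj_on_eq_iff[OF inj] that by (simp flip: hom_mult)
  have Z: "h ` ?Z = ?W"
    using comm by (auto simp: group_center_def simp flip: surj)
  have coset: "h ` (?Z #>\<^bsub>G\<^esub> g) = ?W #>\<^bsub>H\<^esub> h g" if "g \<in> carrier G" for g
    using coset_hom(2)[OF homh G.group_center_subset that] Z by simp
  have rc: "C \<subseteq> carrier G" if "C \<in> rcosets\<^bsub>G\<^esub> ?Z" for C
    using that G.rcosets_subset_PowG[OF G.group_center_subgroup] by blast
  have "(`) h \<in> iso (G Mod ?Z) (H Mod ?W)"
  proof (rule isoI)
    show "(`) h \<in> hom (G Mod ?Z) (H Mod ?W)"
    proof (rule homI)
      fix C assume "C \<in> carrier (G Mod ?Z)"
      then obtain g where "g \<in> carrier G" "C = ?Z #>\<^bsub>G\<^esub> g"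
        by (auto simp: FactGroup_def RCOSETS_def)
      then show "h ` C \<in> carrier (H Mod ?W)"
        using coset by (auto simp: FactGroup_def RCOSETS_def)
    next
      fix C D assume "C \<in> carrier (G Mod ?Z)" "D \<in> carrier (G Mod ?Z)"
      then show "h ` (C \<otimes>\<^bsub>G Mod ?Z\<^esub> D) = h ` C \<otimes>\<^bsub>H Mod ?W\<^esub> h ` D"
        using set_mult_hom[OF homh] rc by (simp add: FactGroup_def)
    qed
    have "inj_on ((`) h) (rcosets\<^bsub>G\<^esub> ?Z)"
      using inj_on_image_Pow[OF inj] rc by (auto intro: inj_on_subset)
    moreover have "(`) h ` (rcosets\<^bsub>G\<^esub> ?Z) = rcosets\<^bsub>H\<^esub> ?W"
      using coset by (auto simp: RCOSETS_def image_iff simp flip: surj)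
    ultimately show "bij_betw ((`) h) (carrier (G Mod ?Z)) (carrier (H Mod ?W))"
      by (simp add: bij_betw_def FactGroup_def)
  qed
  moreover have "h \<in> iso (G\<lparr>carrier := derived G (carrier G)\<rparr>) (H\<lparr>carrier := derived H (carrier H)\<rparr>)"
  proof -
    have sub: "derived G (carrier G) \<subseteq> carrier G" by (simp add: G.derived_in_carrier)
    moreover have "h ` derived G (carrier G) = derived H (carrier H)"
      using derived_img[of "carrier G"] surj by simp
    ultimately show ?thesis
      using inj by (auto simp: iso_def hom_def bij_betw_def subset_iff intro: inj_on_subset)
  qed
  moreover have "h (commutator G g1 g2) = commutator H h1 h2"
    if "g1 \<in> carrier G" "g2 \<in> carrier G" "h1 \<in> carrier H" "h2 \<in> carrier H"
      "h ` (?Z #>\<^bsub>G\<^esub> g1) = ?W #>\<^bsub>H\<^esub> h1" "h ` (?Z #>\<^bsub>G\<^esub> g2) = ?W #>\<^bsub>H\<^esub> h2" for g1 g2 h1 h2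
  proof -
    have "h (commutator G g1 g2) = commutator H (h g1) (h g2)"
      using that(1,2) by (simp add: commutator_def)
    also have "\<dots> = commutator H h1 h2"
      using that(1-4) that(5,6)[unfolded coset[OF that(1)] coset[OF that(2)]]
      by (intro group.commutator_center_cosets[OF H]) simp_all
    finally show ?thesis .
  qed
  ultimately show ?thesis
    unfolding isoclinic_def by (intro bexI[of _ "(`) h"] bexI[of _ h]) simp_all
qed

section \<open>Abelian groups and the rank\<close>

lemma (in group) derived_trivial:
  assumes "group_center G = carrier G"
  shows "derived G (carrier G) = {\<one>}"
proof -
  have "comm_group G"
    using assms by (intro group_comm_groupI) (auto simp: group_center_def)
  then show ?thesis by (simp add: comm_group.derived_eq_singleton)
qed

lemma (in group) rcosets_carrier: "rcosets (carrier G) = {carrier G}"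
  using coset_join2[OF _ subgroup_self] by (auto simp: RCOSETS_def)

lemma (in group) commutator_eq_one:
  assumes "group_center G = carrier G" "x \<in> carrier G" "y \<in> carrier G"
  shows "commutator G x y = \<one>"
proof -
  have "x \<otimes> y = y \<otimes> x" using assms by (auto simp: group_center_def)
  then show ?thesis using assms by (simp add: commutator_def m_assoc)
qed

text \<open>The central quotients and the derived subgroups are all trivial, so constant maps serve
  as both isomorphisms.\<close>

lemma isoclinic_abelian:
  assumes G: "group G" "group_center G = carrier G" and H: "group H" "group_center H = carrier H"
  shows "isoclinic G H"
proof -
  interpret G: group G by fact
  interpret H: group H by fact
  have "(\<lambda>_. carrier H) \<in> iso (G Mod carrier G) (H Mod carrier H)"
    by (auto simp: iso_def hom_def bij_betw_def FactGroup_def G.rcosets_carrier H.rcosets_carrier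
        H.subgroup_mult_id[OF H.subgroup_self])
  moreover have "(\<lambda>_. \<one>\<^bsub>H\<^esub>) \<in> iso (G\<lparr>carrier := {\<one>\<^bsub>G\<^esub>}\<rparr>) (H\<lparr>carrier := {\<one>\<^bsub>H\<^esub>}\<rparr>)"
    by (auto simp: iso_def hom_def bij_betw_def)
  ultimately show ?thesis
    unfolding isoclinic_def G(2) H(2) G.derived_trivial[OF G(2)] H.derived_trivial[OF H(2)]
    using H.commutator_eq_one[OF H(2)] by fastforce
qed

text \<open>The rank only ranges over groups on \<open>nat\<close>; this moves a finite group there
  along an injection of its carrier.\<close>

lemma (in group) isoclinic_nat_group:
  assumes "finite (carrier G)"
  obtains H :: "nat monoid" where "group H" "order H = order G" "isoclinic G H"
proof -
  obtain f :: "'a \<Rightarrow> nat" where f: "inj_on f (carrier G)"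
    using assms finite_imp_inj_to_nat_seg by metis
  show thesis
  proof
    show H: "group (image_group f G)" using f by (rule inj_imp_image_group_is_group)
    show "order (image_group f G) = order G"
      using f by (simp add: order_def image_group_carrier card_image)
    show "isoclinic G (image_group f G)"
      using is_group H inj_imp_image_group_iso[OF f] by (rule isoclinic_iso)
  qed
qed

text \<open>The trivial group, of order \<open>p ^ 0\<close>, belongs to the family.\<close>

lemma (in group) isoclinic_rank_abelian:
  assumes "group_center G = carrier G"
  shows "isoclinic_rank p G = 0"
proof -
  let ?T = "singleton_group (0 :: nat)"
  have "isoclinic G ?T"
    using assms singleton_group by (intro isoclinic_abelian is_group) (auto simp: group_center_def)
  moreover have "order ?T = p ^ 0" by (simp add: order_def)
  ultimately have "\<exists>H :: nat monoid. group H \<and> order H = p ^ 0 \<and> isoclinic G H"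
    by (intro exI[of _ ?T]) simp
  then show ?thesis unfolding isoclinic_rank_def by (rule Least_eq_0)
qed

text \<open>The minimum in the definition of the rank is attained, because a copy of the group
  itself on \<open>nat\<close> makes \<open>m\<close> an admissible exponent.\<close>

lemma (in group) isoclinic_rank_witness:
  assumes "order G = p ^ m" "p > 0"
  obtains H :: "nat monoid" where "group H" "order H = p ^ isoclinic_rank p G" "isoclinic G H"
proof -
  have "finite (carrier G)" using assms by (simp flip: order_gt_0_iff_finite)
  then obtain H :: "nat monoid" where "group H" "order H = order G" "isoclinic G H"
    by (rule isoclinic_nat_group)
  then have "\<exists>r. \<exists>H :: nat monoid. group H \<and> order H = p ^ r \<and> isoclinic G H"
    using assms(1) by (intro exI[of _ m] exI[of _ H]) simp
  then have "\<exists>H :: nat monoid. group H \<and> order H = p ^ isoclinic_rank p G \<and> isoclinic G H"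
    unfolding isoclinic_rank_def by (rule LeastI_ex)
  then show thesis using that by blast
qed

lemma (in group) center_index_prime_square_rank3:
  assumes p: "prime p" and ord: "order G = p ^ m" and rank: "isoclinic_rank p G = 3"
  shows "center_index_prime_square G p"
proof -
  have "p > 0" using p by (rule prime_gt_0_nat)
  then have fin: "finite (carrier G)" using ord by (simp flip: order_gt_0_iff_finite)
  obtain H :: "nat monoid" where H: "group H" "order H = p ^ 3" "isoclinic G H"
    using isoclinic_rank_witness[OF ord \<open>p > 0\<close>] unfolding rank by blast
  have L: "card (rcosets (group_center G)) * card (group_center G) = order G"
    using group_center_subgroup by (rule lagrange)
  \<comment> \<open>Index 1 would make the group abelian, hence of rank 0 rather than 3.\<close>
  have "card (rcosets (group_center G)) \<noteq> 1"
  proof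
    assume "card (rcosets (group_center G)) = 1"
    then have "group_center G = carrier G"
      using L fin group_center_subset by (intro card_subset_eq) (auto simp: order_def)
    then show False using isoclinic_rank_abelian rank by simp
  qed
  then have "card (rcosets (group_center G)) = p\<^sup>2"
    using group.center_index_order_prime_cubed[OF H(1) p H(2)] isoclinic_card_center_cosets[OF H(3)] by simp
  then show ?thesis using L fin p by unfold_locales simp_all
qed

theorem lemma5p1:
  fixes G :: "('a, 'b) monoid_scheme" and p m :: nat
  assumes "prime p" and "odd p"
    and "group G" and "order G = p ^ m"
    and "isoclinic_rank p G = 3"
  shows "conj_fps G oo (fps_const (1 / of_nat (order G)) * fps_X) =
           fps_const (1 - 1 / of_nat p ^ 2) / (1 - fps_const (1 / of_nat p) * fps_X)
           + fps_const (1 / of_nat p ^ 2) / (1 - fps_X)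
         \<and> comm_conj_fps G oo (fps_const (1 / of_nat (order G)) * fps_X) =
           fps_const (- (1 / of_nat p)) / (1 - fps_const (1 / of_nat p ^ 2) * fps_X)
           + fps_const (1 + 1 / of_nat p) / (1 - fps_const (1 / of_nat p) * fps_X)"
proof -
  interpret center_index_prime_square G p
    using assms by (intro group.center_index_prime_square_rank3)
  show ?thesis using conj_fps_eq comm_conj_fps_eq by blast
qed

end
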